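(* Let $I\subseteq(0,\infty)$ be an interval, let $f:I\to\mathbb{R}$ be differentiable on the interior $I^{\circ}$ of $I$, let $a,b\in I$ with $a<b$, and let $g:[a,b]\to[0,\infty)$ be a continuous positive function that is geometrically symmetric with respect to $\sqrt{ab}$. Let $p,q>1$ with $\frac1q+\frac1p=1$, let $\alpha>0$, and put $G=\sqrt{ab}$ and $\|g\|_\infty=\sup_{x\in[a,b]}|g(x)|$. If $|f'|^q$ is GA-convex on $[a,b]$, then $$\left|\frac{f(a)+f(b)}{2}\left[J_{a^+}^{\alpha}g(b)+J_{b^-}^{\alpha}g(a)\right]-\left[J_{a^+}^{\alpha}(fg)(b)+J_{b^-}^{\alpha}(fg)(a)\right]\right|$$ $$\le\frac{(\ln b-\ln a)^{\alpha+1}\|g\|_\infty}{2^{\alpha+1}\Gamma(\alpha+1)}\left(\frac{2^{\alpha+2}-2^2}{\alpha+1}\right)^{1-\frac1q}\Big[C_1(\alpha,q)|f'(a)|^q+C_2(\alpha,q)|f'(G)|^q+C_3(\alpha,q)|f'(b)|^q\Big]^{\frac1q},$$ where $$C_1(\alpha,q)=\int_0^1\left[(1+t)^\alpha-(1-t)^\alpha\right]t\,a^{qt}G^{q(1-t)}\,dt,$$ $$C_2(\alpha,q)=\int_0^1\left[(1+t)^\alpha-(1-t)^\alpha\right](1-t)\left(a^{qt}G^{q(1-t)}+b^{qt}G^{q(1-t)}\right)dt,$$ $$C_3(\alpha,q)=\int_0^1\left[(1+t)^\alpha-(1-t)^\alpha\right]t\,b^{qt}G^{q(1-t)}\,dt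.$$
   Context: A function $\varphi:J\to\mathbb{R}$ on an interval $J\subseteq(0,\infty)$ is GA-convex on $J$ if $\varphi(x^{\lambda}y^{1-\lambda})\le\lambda\varphi(x)+(1-\lambda)\varphi(y)$ for all $x,y\in J$ and $\lambda\in[0,1]$. A function $g$ on $[a,b]$ is geometrically symmetric with respect to $\sqrt{ab}$ if $g(ab/x)=g(x)$ for all $x\in[a,b]$. For integrable $u$ on $[a,b]$ and $\alpha>0$, the Hadamard fractional integrals of order $\alpha$ are $$J_{a^+}^{\alpha}u(x)=\frac1{\Gamma(\alpha)}\int_a^x\left(\ln\frac xt\right)^{\alpha-1}u(t)\frac{dt}{t}\quad(x>a),\qquad J_{b^-}^{\alpha}u(x)=\frac1{\Gamma(\alpha)}\int_x^b\left(\ln\frac tx\right)^{\alpha-1}u(t)\frac{dt}{t}\quad(x<b),$$ where $\Gamma$ is the Gamma function. $fg$ denotes the pointwise product. *)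

theory Defs
  imports "HOL-Analysis.Analysis"
begin

definition GA_convex_on :: "real set \<Rightarrow> (real \<Rightarrow> real) \<Rightarrow> bool" where
  "GA_convex_on J \<phi> \<longleftrightarrow> is_interval J \<and> J \<subseteq> {0<..} \<and>
     (\<forall>x\<in>J. \<forall>y\<in>J. \<forall>l\<in>{0..1}.
        \<phi> (x powr l * y powr (1 - l)) \<le> l * \<phi> x + (1 - l) * \<phi> y)"

definition geometrically_symmetric :: "real \<Rightarrow> real \<Rightarrow> (real \<Rightarrow> real) \<Rightarrow> bool" where
  "geometrically_symmetric a b g \<longleftrightarrow> (\<forall>x\<in>{a..b}. g (a * b / x) = g x)"

(* Hadamard fractional integrals as Lebesgue integrals. For \<alpha> < 1 the kernel is singular at
   t = x; there powr gives 0 powr (\<alpha> - 1) = 0, which is immaterial since {x} is a null set. *)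

definition hadamard_left :: "real \<Rightarrow> real \<Rightarrow> (real \<Rightarrow> real) \<Rightarrow> real \<Rightarrow> real" where
  "hadamard_left \<alpha> a u x =
     1 / Gamma \<alpha> * (LINT t:{a..x}|lebesgue. ln (x / t) powr (\<alpha> - 1) * u t / t)"

definition hadamard_right :: "real \<Rightarrow> real \<Rightarrow> (real \<Rightarrow> real) \<Rightarrow> real \<Rightarrow> real" where
  "hadamard_right \<alpha> b u x =
     1 / Gamma \<alpha> * (LINT t:{x..b}|lebesgue. ln (t / x) powr (\<alpha> - 1) * u t / t)"

definition C1 :: "real \<Rightarrow> real \<Rightarrow> real \<Rightarrow> real \<Rightarrow> real" where
  "C1 \<alpha> q a b = (let G = sqrt (a * b) in
     LINT t:{0..1}|lebesgue. ((1 + t) powr \<alpha> - (1 - t) powr \<alpha>) * t *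
       (a powr (q * t) * G powr (q * (1 - t))))"

definition C2 :: "real \<Rightarrow> real \<Rightarrow> real \<Rightarrow> real \<Rightarrow> real" where
  "C2 \<alpha> q a b = (let G = sqrt (a * b) in
     LINT t:{0..1}|lebesgue. ((1 + t) powr \<alpha> - (1 - t) powr \<alpha>) * (1 - t) *
       (a powr (q * t) * G powr (q * (1 - t)) + b powr (q * t) * G powr (q * (1 - t))))"

definition C3 :: "real \<Rightarrow> real \<Rightarrow> real \<Rightarrow> real \<Rightarrow> real" where
  "C3 \<alpha> q a b = (let G = sqrt (a * b) in
     LINT t:{0..1}|lebesgue. ((1 + t) powr \<alpha> - (1 - t) powr \<alpha>) * t *
       (b powr (q * t) * G powr (q * (1 - t))))"

end

(* The parametrisation t = G (b/a)^(s/2), s in [-1,1], turns the two Hadamard integrals into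
   Riemann-Liouville integrals, and with h, F the pull-backs of g, f the symmetry of g makes the
   left-hand side a multiple of
     int_{-1}^{1} (1-s)^(alpha-1) h(s) (F(1) + F(-1) - F(s) - F(-s)) ds.
   Folding it onto [0,1] and integrating by parts gives the weight (1+s)^alpha - (1-s)^alpha against
   |F'(s)| + |F'(-s)|; Hoelder's inequality with this weight and GA-convexity of |f'|^q finish.
   GA-convexity bounds |F'(s)| and |F'(-s)| by explicit continuous functions before anything is
   integrated, so f' itself never appears under an integral. *)

theory Submission
  imports Defs
begin

section \<open>Weighted Hoelder inequality for a pair of functions\<close>

text \<open>This is Hoelder with exponents 1/r and 1/(1-r) for the measure k dt on two disjoint
  copies of the interval, \<open>X\<close> living on one and \<open>Y\<close> on the other. The
  total mass is therefore twice the integral of \<open>k\<close>. It is derived by integrating a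
  pointwise Young inequality.\<close>

lemma integral_powr_sum_le:
  fixes k X Y :: "real \<Rightarrow> real"
  assumes cont: "continuous_on {a..b} k" "continuous_on {a..b} X" "continuous_on {a..b} Y"
    and nonneg: "\<And>t. t \<in> {a..b} \<Longrightarrow> 0 \<le> k t" "\<And>t. t \<in> {a..b} \<Longrightarrow> 0 \<le> X t"
      "\<And>t. t \<in> {a..b} \<Longrightarrow> 0 \<le> Y t"
    and ab: "a < b" and r: "0 < r" "r < 1"
    and M: "0 < integral {a..b} k"
  shows "integral {a..b} (\<lambda>t. k t * (X t powr r + Y t powr r))
    \<le> (2 * integral {a..b} k) powr (1 - r) * integral {a..b} (\<lambda>t. k t * (X t + Y t)) powr r"
proof -
  define S where "S = integral {a..b} (\<lambda>t. k t * (X t + Y t))"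
  let ?M = "2 * integral {a..b} k"
  have contp: "continuous_on {a..b} (\<lambda>t. k t * (X t powr r + Y t powr r))"
    by (intro continuous_intros continuous_on_powr' cont) (use nonneg r in auto)
  have conts: "continuous_on {a..b} (\<lambda>t. k t * (X t + Y t))"
    by (intro continuous_intros cont)
  have S0: "0 \<le> S"
    unfolding S_def by (rule integral_nonneg) (use nonneg conts in \<open>auto intro: integrable_continuous_real\<close>)
  show ?thesis
  \<comment> \<open>The constant \<open>c\<close> chosen below would be 0 here. Continuity makes
    \<open>k t * (X t + Y t)\<close> vanish pointwise, so at each point \<open>k\<close> is 0 or
    both \<open>X\<close> and \<open>Y\<close> are, and \<open>0 powr r = 0\<close> kills the left
    side.\<close>
  proof (cases "S = 0")
    case True
    then have z: "k t * (X t + Y t) = 0" if "t \<in> {a..b}" for t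
      using integral_eq_0_iff[OF conts ab] nonneg that unfolding S_def by auto
    have "k t * (X t powr r + Y t powr r) = 0" if "t \<in> {a..b}" for t
      using z[OF that] nonneg[OF that] by (auto simp: add_nonneg_eq_0_iff)
    then have "integral {a..b} (\<lambda>t. k t * (X t powr r + Y t powr r)) = integral {a..b} (\<lambda>t. 0)"
      by (intro integral_cong) auto
    then show ?thesis by simp
  next
    case False
    with S0 have S: "0 < S" by simp
    \<comment> \<open>\<open>c\<close> is the mean of \<open>X\<close> and \<open>Y\<close> over the
      doubled measure. With this choice the integrated Young bound r S + (1-r) c M collapses to
      S.\<close>
    define c where "c = S / ?M"
    have c: "0 < c" using S M by (simp add: c_def)
    have young: "x powr r * c powr (1 - r) \<le> r * x + (1 - r) * c" if "0 \<le> x" for x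
      using Youngs_inequality_0[of r "1 - r" x c] that r c by (cases "x = 0") auto
    have "integral {a..b} (\<lambda>t. k t * (X t powr r + Y t powr r)) * c powr (1 - r)
      = integral {a..b} (\<lambda>t. k t * (X t powr r + Y t powr r) * c powr (1 - r))"
      by simp
    also have "\<dots> \<le> integral {a..b} (\<lambda>t. r * (k t * (X t + Y t)) + 2 * (1 - r) * c * k t)"
    proof (rule integral_le)
      fix t assume t: "t \<in> {a..b}"
      have "k t * (X t powr r * c powr (1 - r) + Y t powr r * c powr (1 - r))
        \<le> k t * ((r * X t + (1 - r) * c) + (r * Y t + (1 - r) * c))"
        by (intro mult_left_mono add_mono young nonneg t)
      then show "k t * (X t powr r + Y t powr r) * c powr (1 - r)
        \<le> r * (k t * (X t + Y t)) + 2 * (1 - r) * c * k t"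
        by (simp add: algebra_simps)
    qed (intro integrable_continuous_real continuous_intros contp conts cont)+
    also have "\<dots> = r * S + (1 - r) * c * ?M"
      unfolding S_def
      by (subst integral_add) (auto intro!: integrable_continuous_real continuous_intros conts cont)
    also have "\<dots> = S"
      using M by (simp add: c_def field_simps)
    finally have "integral {a..b} (\<lambda>t. k t * (X t powr r + Y t powr r)) \<le> S / c powr (1 - r)"
      using c by (simp add: field_simps)
    also have "S / c powr (1 - r) = ?M powr (1 - r) * S powr r"
      using S M by (simp add: c_def powr_divide powr_diff)
    finally show ?thesis unfolding S_def .
  qed
qed

section \<open>The singular kernel and the folded integral on [-1,1]\<close>

text \<open>For \<alpha> < 1 the kernel is unbounded at s = 1, but its antiderivative
  -(1-s)^\<alpha>/\<alpha> stays continuous there because \<alpha> > 0. Hence the form of the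
  fundamental theorem that asks for derivatives in the interior only.\<close>

lemma one_minus_powr_absolutely_integrable:
  fixes \<alpha> :: real
  assumes "0 < \<alpha>"
  shows "(\<lambda>s. (1 - s) powr (\<alpha> - 1)) absolutely_integrable_on {-1..1}"
proof (rule nonnegative_absolutely_integrable_1)
  have "((\<lambda>s. (1 - s) powr (\<alpha> - 1)) has_integral
      (- ((1 - 1) powr \<alpha> / \<alpha>) - - ((1 - (-1)) powr \<alpha> / \<alpha>))) {-1..1::real}"
  proof (rule fundamental_theorem_of_calculus_interior)
    show "continuous_on {-1..1} (\<lambda>s. - ((1 - s) powr \<alpha> / \<alpha>))"
      by (intro continuous_intros continuous_on_powr') (use assms in auto)
    show "((\<lambda>s. - ((1 - s) powr \<alpha> / \<alpha>)) has_vector_derivative (1 - x) powr (\<alpha> - 1)) (at x)"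
      if "x \<in> {-1<..<1}" for x
      unfolding has_real_derivative_iff_has_vector_derivative[symmetric]
      by (rule derivative_eq_intros refl | use that assms in simp)+
  qed simp
  then show "(\<lambda>s. (1 - s) powr (\<alpha> - 1)) integrable_on {-1..1::real}" by blast
qed simp

lemma one_minus_powr_mult_absolutely_integrable:
  fixes \<alpha> :: real
  assumes "0 < \<alpha>" and u: "continuous_on {-1..1} u"
  shows "(\<lambda>s. (1 - s) powr (\<alpha> - 1) * u s) absolutely_integrable_on {-1..1}"
proof -
  have "(\<lambda>s. u s * (1 - s) powr (\<alpha> - 1)) absolutely_integrable_on {-1..1}"
    by (rule absolutely_integrable_bounded_measurable_product_real)
      (use u one_minus_powr_absolutely_integrable[OF assms(1)] in
        \<open>auto intro: continuous_imp_measurable_on_sets_lebesgue compact_imp_bounded compact_continuous_image\<close>)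
  then show ?thesis by (simp add: mult.commute)
qed

text \<open>The bracket vanishes at s = 1 and its derivative is dominated by \<open>\<Phi>\<close>,
  so it is at most the integral of \<open>\<Phi>\<close> from s to 1. Integration by parts is
  applied to this majorant rather than to the bracket, so a pointwise bound on \<open>F'\<close>
  suffices.\<close>

lemma weighted_second_difference_bound:
  fixes F F' h \<Phi> :: "real \<Rightarrow> real"
  assumes \<alpha>: "0 < \<alpha>"
    and h: "continuous_on {-1..1} h" "\<And>s. s \<in> {-1..1} \<Longrightarrow> 0 \<le> h s"
      "\<And>s. s \<in> {-1..1} \<Longrightarrow> h s \<le> N" "\<And>s. s \<in> {-1..1} \<Longrightarrow> h (- s) = h s"
    and F: "continuous_on {-1..1} F"
      "\<And>s. s \<in> {-1<..<1} \<Longrightarrow> (F has_real_derivative F' s) (at s)"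
    and \<Phi>: "continuous_on {0..1} \<Phi>"
      "\<And>s. s \<in> {0<..<1} \<Longrightarrow> \<bar>F' s\<bar> + \<bar>F' (- s)\<bar> \<le> \<Phi> s"
  shows "\<bar>integral {-1..1} (\<lambda>s. (1 - s) powr (\<alpha> - 1) * (h s * (F 1 + F (-1) - F s - F (- s))))\<bar>
    \<le> N / \<alpha> * integral {0..1} (\<lambda>s. ((1 + s) powr \<alpha> - (1 - s) powr \<alpha>) * \<Phi> s)"
proof -
  define D where "D = (\<lambda>s. F 1 + F (-1) - F s - F (- s))"
  define \<psi> where "\<psi> = (\<lambda>s. (1 - s) powr (\<alpha> - 1) * (h s * D s))"
  \<comment> \<open>The integral of \<open>\<Phi>\<close> from s to 1, written as a difference so
    that differentiation in the upper limit applies.\<close>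
  define R where "R = (\<lambda>s. integral {0..1} \<Phi> - integral {0..s} \<Phi>)"
  define k where "k = (\<lambda>s. (1 + s) powr \<alpha> - (1 - s) powr \<alpha>)"
  \<comment> \<open>The kernel after folding s and -s together; \<open>\<alpha> * \<kappa> s\<close>
    is the derivative of \<open>k\<close>.\<close>
  define \<kappa> where "\<kappa> = (\<lambda>s. (1 - s) powr (\<alpha> - 1) + (1 + s) powr (\<alpha> - 1))"
  have contFm: "continuous_on {-1..1} (\<lambda>s. F (- s))"
    by (rule continuous_on_compose2[OF F(1)]) (auto intro!: continuous_intros)
  have contD: "continuous_on {-1..1} D"
    unfolding D_def by (intro continuous_intros F contFm)
  have \<psi>_int: "\<psi> integrable_on {-1..1}"
    unfolding \<psi>_def
    by (intro set_lebesgue_integral_eq_integral(1) one_minus_powr_mult_absolutely_integrable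
        continuous_intros \<alpha> h contD)
  have \<psi>_int01: "\<psi> integrable_on {0..1}" "\<psi> integrable_on {-1..0}"
    by (rule integrable_on_subinterval[OF \<psi>_int]; simp)+
  have \<psi>m_int01: "(\<lambda>s. \<psi> (- s)) integrable_on {0..1}"
    using \<psi>_int01(2) Henstock_Kurzweil_Integration.integrable_reflect_real[where f = \<psi> and a = "-1" and b = 0] by simp
  \<comment> \<open>\<open>h\<close> and \<open>D\<close> are both even, so only the two kernels add
    up.\<close>
  have fold: "\<psi> s + \<psi> (- s) = \<kappa> s * (h s * D s)" if "s \<in> {0..1}" for s
    using h(4)[of s] that by (simp add: \<psi>_def \<kappa>_def D_def algebra_simps)
  have R_deriv: "(R has_vector_derivative - \<Phi> s) (at s)" if "s \<in> {0<..<1}" for s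
  proof -
    have "((\<lambda>u. integral {0..u} \<Phi>) has_vector_derivative \<Phi> s) (at s within {0..1})"
      by (rule integral_has_vector_derivative[OF \<Phi>(1)]) (use that in auto)
    moreover have "at s within {0..1} = at s"
      by (rule at_within_interior) (use that in simp)
    ultimately have "((\<lambda>u. integral {0..u} \<Phi>) has_vector_derivative \<Phi> s) (at s)" by simp
    from has_vector_derivative_diff[OF has_vector_derivative_const this]
    show ?thesis by (simp add: R_def)
  qed
  have R_cont: "continuous_on {0..1} R"
    unfolding R_def
    by (intro continuous_intros indefinite_integral_continuous_1 integrable_continuous_real \<Phi>)
  have D_le: "\<bar>D s\<bar> \<le> R s" if s: "s \<in> {0..1}" for s
  proof (cases "s = 1")
    case True
    then show ?thesis by (simp add: D_def R_def)
  next
    case False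
    then have "s < 1" using s by simp
    \<comment> \<open>Comparison form of the mean value theorem on [s,1], with \<open>- R\<close> as
      the dominating function; both \<open>D 1\<close> and \<open>R 1\<close> are 0.\<close>
    have "norm (D 1 - D s) \<le> (- R 1) - (- R s)"
    proof (rule differentiable_bound_general[OF \<open>s < 1\<close>])
      show "continuous_on {s..1} D" "continuous_on {s..1} (\<lambda>s. - R s)"
        using s by (auto intro!: continuous_intros continuous_on_subset[OF contD]
            continuous_on_subset[OF R_cont])
      fix x assume x: "s < x" "x < 1"
      show "((\<lambda>s. - R s) has_vector_derivative \<Phi> x) (at x)"
        using has_vector_derivative_minus[OF R_deriv[of x]] x s by simp
      have "(F has_real_derivative F' x) (at x)" "(F has_real_derivative F' (- x)) (at (- x))"
        using x s by (auto intro!: F(2))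
      then have "(D has_real_derivative (0 - F' x - F' (- x) * (- 1))) (at x)"
        unfolding D_def
        by (intro derivative_intros DERIV_chain'[where f = uminus and g = F, OF DERIV_minus[OF DERIV_ident]])
      then show "(D has_vector_derivative (F' (- x) - F' x)) (at x)"
        by (simp add: has_real_derivative_iff_has_vector_derivative)
      show "norm (F' (- x) - F' x) \<le> \<Phi> x"
        using \<Phi>(2)[of x] x s by auto
    qed
    then show ?thesis by (simp add: D_def R_def)
  qed
  have k_cont: "continuous_on {0..1} k"
    unfolding k_def by (intro continuous_intros continuous_on_powr') (use \<alpha> in auto)
  have k\<Phi>: "(\<lambda>s. k s * \<Phi> s) integrable_on {0..1}"
    by (intro integrable_continuous_real continuous_intros k_cont \<Phi>)
  \<comment> \<open>Integration by parts: \<^term>\<open>k\<close> vanishes at 0 and \<^term>\<open>R\<close> vanishes at 1.\<close>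
  have "((\<lambda>s. \<alpha> * (\<kappa> s * R s) - k s * \<Phi> s) has_integral (k 1 * R 1 - k 0 * R 0)) {0..1}"
  proof (rule fundamental_theorem_of_calculus_interior)
    show "continuous_on {0..1} (\<lambda>s. k s * R s)"
      by (intro continuous_intros k_cont R_cont)
    fix x :: real assume x: "x \<in> {0<..<1}"
    have "(k has_real_derivative \<alpha> * \<kappa> x) (at x)"
      unfolding k_def \<kappa>_def
      by (rule derivative_eq_intros refl | use x in \<open>simp add: algebra_simps\<close>)+
    then show "((\<lambda>s. k s * R s) has_vector_derivative \<alpha> * (\<kappa> x * R x) - k x * \<Phi> x) (at x)"
      using has_vector_derivative_mult[OF _ R_deriv[OF x], of k "\<alpha> * \<kappa> x"]
      by (simp add: has_real_derivative_iff_has_vector_derivative algebra_simps)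
  qed simp
  \<comment> \<open>Adding back the continuous term \<open>k s * \<Phi> s\<close> yields both the
    integrability of \<open>\<kappa> s * R s\<close>, where \<open>\<kappa>\<close> may be singular
    at 1, and its value.\<close>
  from has_integral_add[OF this integrable_integral[OF k\<Phi>]]
  have "((\<lambda>s. \<alpha> * (\<kappa> s * R s)) has_integral integral {0..1} (\<lambda>s. k s * \<Phi> s)) {0..1}"
    by (simp add: k_def R_def)
  from has_integral_mult_right[OF this, of "N / \<alpha>"]
  have NR: "((\<lambda>s. N * (\<kappa> s * R s)) has_integral N / \<alpha> * integral {0..1} (\<lambda>s. k s * \<Phi> s)) {0..1}"
    using \<alpha> by simp
  have "integral {-1..1} \<psi> = integral {-1..0} \<psi> + integral {0..1} \<psi>"
    by (rule Henstock_Kurzweil_Integration.integral_combine[symmetric]) (use \<psi>_int in auto)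
  also have "integral {-1..0} \<psi> = integral {0..1} (\<lambda>s. \<psi> (- s))"
    using Henstock_Kurzweil_Integration.integral_reflect_real[where f = \<psi> and a = "-1" and b = 0] by simp
  also have "integral {0..1} (\<lambda>s. \<psi> (- s)) + integral {0..1} \<psi>
      = integral {0..1} (\<lambda>s. \<psi> s + \<psi> (- s))"
    by (simp add: integral_add \<psi>_int01 \<psi>m_int01)
  finally have "\<bar>integral {-1..1} \<psi>\<bar> = norm (integral {0..1} (\<lambda>s. \<psi> s + \<psi> (- s)))"
    by simp
  also have "\<dots> \<le> integral {0..1} (\<lambda>s. N * (\<kappa> s * R s))"
  proof (rule Henstock_Kurzweil_Integration.integral_norm_bound_integral)
    show "(\<lambda>s. \<psi> s + \<psi> (- s)) integrable_on {0..1}"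
      by (intro integrable_add \<psi>_int01 \<psi>m_int01)
    show "(\<lambda>s. N * (\<kappa> s * R s)) integrable_on {0..1}" using NR by blast
    fix s :: real assume s: "s \<in> {0..1}"
    have "norm (\<psi> s + \<psi> (- s)) = h s * (\<kappa> s * \<bar>D s\<bar>)"
      using h(2)[of s] s by (simp add: fold abs_mult) (simp add: \<kappa>_def)
    also have "\<dots> \<le> N * (\<kappa> s * R s)"
      using h(2,3)[of s] s D_le[OF s] by (intro mult_mono mult_left_mono) (auto simp: \<kappa>_def)
    finally show "norm (\<psi> s + \<psi> (- s)) \<le> N * (\<kappa> s * R s)" .
  qed
  also have "\<dots> = N / \<alpha> * integral {0..1} (\<lambda>s. k s * \<Phi> s)"
    using NR by (rule integral_unique)
  finally show ?thesis by (simp add: \<psi>_def D_def k_def)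
qed

section \<open>The logarithmic path and the change of variables\<close>

text \<open>Writing the path through \<open>exp\<close> and \<open>ln\<close> makes its logarithm
  affine in s, with midpoint s = 0 at sqrt(ab).\<close>

definition geo_path :: "real \<Rightarrow> real \<Rightarrow> real \<Rightarrow> real" where
  "geo_path a b s = exp (((1 - s) * ln a + (1 + s) * ln b) / 2)"

context
  fixes a b :: real
  assumes a: "0 < a" and ab: "a < b"
begin

lemma geo_path_pos: "0 < geo_path a b s"
  by (simp add: geo_path_def)

lemma ln_geo_path: "ln (geo_path a b s) = ((1 - s) * ln a + (1 + s) * ln b) / 2"
  by (simp add: geo_path_def)

lemma geo_path_ends [simp]: "geo_path a b (-1) = a" "geo_path a b 1 = b"
  using a ab by (simp_all add: geo_path_def)

lemma geo_path_0: "geo_path a b 0 = sqrt (a * b)"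
proof -
  have [symmetric]: "ln (sqrt (a * b)) = (ln a + ln b) / 2"
    using a ab by (simp add: ln_sqrt ln_mult)
  moreover have "exp (ln (sqrt (a * b))) = sqrt (a * b)"
    using a ab by simp
  ultimately have "exp ((ln a + ln b) / 2) = sqrt (a * b)" by (simp only:)
  then show ?thesis by (simp add: geo_path_def)
qed

lemma geo_path_less_iff [simp]: "geo_path a b s < geo_path a b t \<longleftrightarrow> s < t"
proof -
  have "((1 - t) * ln a + (1 + t) * ln b) - ((1 - s) * ln a + (1 + s) * ln b)
      = (t - s) * (ln b - ln a)"
    by (simp add: algebra_simps)
  moreover have "0 < ln b - ln a" using a ab by simp
  ultimately show ?thesis
    unfolding geo_path_def exp_less_cancel_iff
    by (smt (verit) zero_less_mult_iff divide_less_cancel)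
qed

lemma geo_path_le_iff [simp]: "geo_path a b s \<le> geo_path a b t \<longleftrightarrow> s \<le> t"
  using geo_path_less_iff[of t s] by (simp add: not_less[symmetric] del: geo_path_less_iff)

lemma geo_path_inj: "inj_on (geo_path a b) S"
  by (rule inj_onI) (metis geo_path_le_iff order_antisym order_refl)

lemma geo_path_in_iff:
  "geo_path a b s \<in> {a..b} \<longleftrightarrow> s \<in> {-1..1}" "geo_path a b s \<in> {a<..<b} \<longleftrightarrow> s \<in> {-1<..<1}"
  using geo_path_le_iff[of "-1" s] geo_path_le_iff[of s 1]
    geo_path_less_iff[of "-1" s] geo_path_less_iff[of s 1]
  by (simp_all del: geo_path_le_iff geo_path_less_iff)

lemma geo_path_deriv:
  "(geo_path a b has_real_derivative geo_path a b s * ((ln b - ln a) / 2)) (at s within S)"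
  unfolding geo_path_def[abs_def]
  by (rule derivative_eq_intros refl | simp add: field_simps)+

lemma geo_path_continuous_on: "continuous_on S (geo_path a b)"
  unfolding geo_path_def by (intro continuous_intros) auto

lemma geo_path_image: "geo_path a b ` {-1..1} = {a..b}"
proof (intro subset_antisym image_subsetI subsetI)
  fix x assume "x \<in> {a..b}"
  then obtain s where "-1 \<le> s" "s \<le> 1" "geo_path a b s = x"
    using IVT'[of "geo_path a b" "-1" x 1] geo_path_continuous_on by auto
  then show "x \<in> geo_path a b ` {-1..1}" by auto
qed (simp only: geo_path_in_iff)

text \<open>The reflection x -> ab/x becomes s -> -s, so geometric symmetry of a function turns into
  evenness of its pull-back.\<close>

lemma geo_path_reflect: "a * b / geo_path a b s = geo_path a b (- s)"
proof -
  have "geo_path a b s * geo_path a b (- s) = a * b"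
  proof -
    have "((1 - s) * ln a + (1 + s) * ln b) / 2 + ((1 - - s) * ln a + (1 + - s) * ln b) / 2
        = ln a + ln b"
      by (simp add: field_simps)
    then show ?thesis
      using a ab by (simp add: geo_path_def exp_add flip: exp_add[of "_ / 2" "_ / 2"])
  qed
  then show ?thesis using geo_path_pos[of s] by (simp add: field_simps)
qed

text \<open>Traversing the path backwards (\<open>\<sigma> = - 1\<close>) gives the right-sided Hadamard integral the same
  kernel \<open>(1 - s) powr (\<alpha> - 1)\<close> as the left-sided one.\<close>

lemma set_lebesgue_integral_geo_path:
  assumes \<sigma>: "\<sigma> \<in> {1, -1::real}"
    and w: "(\<lambda>s. w (geo_path a b (\<sigma> * s))) absolutely_integrable_on {-1..1}"
  shows "(LINT t:{a..b}|lebesgue. w t / t)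
    = (ln b - ln a) / 2 * integral {-1..1} (\<lambda>s. w (geo_path a b (\<sigma> * s)))"
proof -
  let ?\<gamma> = "\<lambda>s. geo_path a b (\<sigma> * s)"
  let ?L = "(ln b - ln a) / 2"
  have L: "0 < ?L" using a ab by simp
  \<comment> \<open>The Jacobian carries a factor of the path itself, which cancels the 1/t of the
    Hadamard measure dt/t; the sign of \<open>\<sigma>\<close> disappears in the absolute
    value.\<close>
  have abs_deriv: "\<bar>\<sigma> * (?\<gamma> s * ?L)\<bar> * (w (?\<gamma> s) / ?\<gamma> s) = ?L * w (?\<gamma> s)" for s
    using \<sigma> L geo_path_pos[of "\<sigma> * s"] by (auto simp: abs_mult)
  have img: "?\<gamma> ` {-1..1} = {a..b}"
  proof -
    have "(\<lambda>s. \<sigma> * s) ` {-1..1} = {-1..1}" using \<sigma> by auto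
    then show ?thesis
      using geo_path_image by (metis image_image)
  qed
  have deriv: "(?\<gamma> has_real_derivative \<sigma> * (?\<gamma> s * ?L)) (at s within {-1..1})" for s
  proof -
    have "((\<lambda>s. \<sigma> * s) has_real_derivative \<sigma>) (at s within {-1..1})"
      by (rule derivative_eq_intros refl | simp)+
    from DERIV_chain2[OF geo_path_deriv this] show ?thesis by (simp add: mult_ac)
  qed
  have inj: "inj_on ?\<gamma> {-1..1}"
    using \<sigma> by (auto intro!: inj_onI dest!: inj_onD[OF geo_path_inj[of UNIV]])
  have "(\<lambda>t. w t / t) absolutely_integrable_on ?\<gamma> ` {-1..1} \<and>
      integral (?\<gamma> ` {-1..1}) (\<lambda>t. w t / t) = ?L * integral {-1..1} (\<lambda>s. w (?\<gamma> s))"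
    by (rule iffD1[OF has_absolute_integral_change_of_variables_1'[OF _ deriv inj]])
      (use w in \<open>simp_all add: abs_deriv del: times_divide_eq_left times_divide_eq_right\<close>)
  then show ?thesis
    unfolding img by (simp add: set_lebesgue_integral_eq_integral(2))
qed

lemma ln_div_geo_path:
  "ln (b / geo_path a b s) = (1 - s) * ((ln b - ln a) / 2)"
  "ln (geo_path a b (- s) / a) = (1 - s) * ((ln b - ln a) / 2)"
  using a ab geo_path_pos by (simp_all add: ln_div ln_geo_path less_imp_neq[symmetric] field_simps)

text \<open>The power L^\<alpha> in \<open>c\<close>, with L half the logarithmic length of [a,b],
  is L from the Jacobian times L^(\<alpha>-1) pulled out of the kernel.\<close>

lemma hadamard_geo_path:
  assumes \<alpha>: "0 < \<alpha>" and u: "continuous_on {a..b} u"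
  defines "c \<equiv> ((ln b - ln a) / 2) powr \<alpha> / Gamma \<alpha>"
  shows "hadamard_left \<alpha> a u b
      = c * integral {-1..1} (\<lambda>s. (1 - s) powr (\<alpha> - 1) * u (geo_path a b s))"
    and "hadamard_right \<alpha> b u a
      = c * integral {-1..1} (\<lambda>s. (1 - s) powr (\<alpha> - 1) * u (geo_path a b (- s)))"
proof -
  let ?L = "(ln b - ln a) / 2"
  have L: "0 < ?L" using a ab by simp
  have cont: "continuous_on {-1..1} (\<lambda>s. u (geo_path a b (\<sigma> * s)))" if "\<sigma> \<in> {1, -1}" for \<sigma>
  proof (rule continuous_on_compose2[OF u])
    show "continuous_on {-1..1} (\<lambda>s. geo_path a b (\<sigma> * s))"
      by (rule continuous_on_compose2[OF geo_path_continuous_on[of UNIV]])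
        (auto intro!: continuous_intros)
    show "(\<lambda>s. geo_path a b (\<sigma> * s)) ` {-1..1} \<subseteq> {a..b}"
      using that by (intro image_subsetI, subst geo_path_in_iff) auto
  qed
  \<comment> \<open>One computation for both sides: \<open>\<sigma> = 1\<close> with w(t) =
    ln(b/t)^(\<alpha>-1), and \<open>\<sigma> = -1\<close> with w(t) = ln(t/a)^(\<alpha>-1).\<close>
  have main: "(LINT t:{a..b}|lebesgue. w t * u t / t) = ?L powr \<alpha> *
      integral {-1..1} (\<lambda>s. (1 - s) powr (\<alpha> - 1) * u (geo_path a b (\<sigma> * s)))"
    if \<sigma>: "\<sigma> \<in> {1, -1}"
      and w: "\<And>s. s \<in> {-1..1} \<Longrightarrow> w (geo_path a b (\<sigma> * s)) = ((1 - s) * ?L) powr (\<alpha> - 1)"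
    for \<sigma> w
  proof -
    let ?v = "\<lambda>s. (1 - s) powr (\<alpha> - 1) * u (geo_path a b (\<sigma> * s))"
    have eq: "w (geo_path a b (\<sigma> * s)) * u (geo_path a b (\<sigma> * s)) = ?L powr (\<alpha> - 1) * ?v s"
      if "s \<in> {-1..1}" for s
      using that L by (simp only: w[OF that]) (simp add: powr_mult del: times_divide_eq_right)
    have "?v absolutely_integrable_on {-1..1}"
      by (rule one_minus_powr_mult_absolutely_integrable[OF \<alpha> cont[OF \<sigma>]])
    then have "(\<lambda>s. ?L powr (\<alpha> - 1) * ?v s) absolutely_integrable_on {-1..1}"
      by simp
    then have "(\<lambda>s. w (geo_path a b (\<sigma> * s)) * u (geo_path a b (\<sigma> * s))) absolutely_integrable_on {-1..1}"
      by (rule absolutely_integrable_spike[OF _ negligible_empty]) (use eq in simp)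
    from set_lebesgue_integral_geo_path[OF \<sigma> this]
    have "(LINT t:{a..b}|lebesgue. w t * u t / t)
      = ?L * integral {-1..1} (\<lambda>s. w (geo_path a b (\<sigma> * s)) * u (geo_path a b (\<sigma> * s)))" .
    also have "\<dots> = ?L * (?L powr (\<alpha> - 1) * integral {-1..1} ?v)"
      by (subst integral_cong[OF eq]) auto
    also have "\<dots> = ?L powr \<alpha> * integral {-1..1} ?v"
      using powr_mult_base[of ?L "\<alpha> - 1"] L by (simp only: flip: mult.assoc) simp
    finally show ?thesis .
  qed
  show "hadamard_left \<alpha> a u b
      = c * integral {-1..1} (\<lambda>s. (1 - s) powr (\<alpha> - 1) * u (geo_path a b s))"
    unfolding hadamard_left_def c_def
    by (subst main[of 1]) (simp_all add: ln_div_geo_path)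
  show "hadamard_right \<alpha> b u a
      = c * integral {-1..1} (\<lambda>s. (1 - s) powr (\<alpha> - 1) * u (geo_path a b (- s)))"
    unfolding hadamard_right_def c_def
    by (subst main[of "-1"]) (simp_all add: ln_div_geo_path)
qed

text \<open>By evenness of the pull-back of \<open>g\<close> its left and right integrals coincide,
  which cancels the 1/2, while in the right integral of the product only \<open>f\<close> is still
  taken at the reflected point. Linearity then merges everything into one integral.\<close>

lemma hadamard_trapezoid_geo_path:
  assumes \<alpha>: "0 < \<alpha>" and f: "continuous_on {a..b} f" and g: "continuous_on {a..b} g"
    and sym: "geometrically_symmetric a b g"
  shows "(f a + f b) / 2 * (hadamard_left \<alpha> a g b + hadamard_right \<alpha> b g a)
      - (hadamard_left \<alpha> a (\<lambda>x. f x * g x) b + hadamard_right \<alpha> b (\<lambda>x. f x * g x) a)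
    = ((ln b - ln a) / 2) powr \<alpha> / Gamma \<alpha> * integral {-1..1} (\<lambda>s. (1 - s) powr (\<alpha> - 1) *
        (g (geo_path a b s) * (f b + f a - f (geo_path a b s) - f (geo_path a b (- s)))))"
proof -
  define h where "h = (\<lambda>s. g (geo_path a b s))"
  define F where "F = (\<lambda>s. f (geo_path a b s))"
  have h_even: "g (geo_path a b (- s)) = h s" if "s \<in> {-1..1}" for s
    using sym that geo_path_in_iff(1)[of s]
    by (simp add: geometrically_symmetric_def h_def flip: geo_path_reflect)
  have comp: "continuous_on {-1..1} (\<lambda>s. u (geo_path a b s))" if "continuous_on {a..b} u" for u
    by (rule continuous_on_compose2[OF that geo_path_continuous_on]) (simp add: geo_path_image)
  have hc: "continuous_on {-1..1} h" and Fc: "continuous_on {-1..1} F"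
    unfolding h_def F_def by (intro comp f g)+
  have Fc': "continuous_on {-1..1} (\<lambda>s. F (- s))"
    by (rule continuous_on_compose2[OF Fc]) (auto intro!: continuous_intros)
  have int: "(\<lambda>s. (1 - s) powr (\<alpha> - 1) * v s) integrable_on {-1..1}"
    if "continuous_on {-1..1} v" for v
    by (rule set_lebesgue_integral_eq_integral(1)[OF
          one_minus_powr_mult_absolutely_integrable[OF \<alpha> that]])
  let ?I = "\<lambda>v. integral {-1..1} (\<lambda>s. (1 - s) powr (\<alpha> - 1) * v s)"
  have "?I (\<lambda>s. h s * (f b + f a - F s - F (- s)))
    = integral {-1..1} (\<lambda>s. (f a + f b) * ((1 - s) powr (\<alpha> - 1) * h s)
      - (1 - s) powr (\<alpha> - 1) * (F s * h s) - (1 - s) powr (\<alpha> - 1) * (F (- s) * h s))"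
    by (simp add: algebra_simps)
  also have "\<dots> = (f a + f b) * ?I h - ?I (\<lambda>s. F s * h s) - ?I (\<lambda>s. F (- s) * h s)"
  proof -
    have ints: "(\<lambda>s. (f a + f b) * ((1 - s) powr (\<alpha> - 1) * h s)) integrable_on {-1..1}"
      "(\<lambda>s. (1 - s) powr (\<alpha> - 1) * (F s * h s)) integrable_on {-1..1}"
      "(\<lambda>s. (1 - s) powr (\<alpha> - 1) * (F (- s) * h s)) integrable_on {-1..1}"
      using int[OF hc, THEN integrable_on_cmult_left, of "f a + f b"]
      by (auto intro!: int continuous_on_mult hc Fc Fc')
    show ?thesis
      by (simp only: Henstock_Kurzweil_Integration.integral_diff integrable_diff ints
          Henstock_Kurzweil_Integration.integral_mult_right)
  qed
  finally have eq: "?I (\<lambda>s. h s * (f b + f a - F s - F (- s)))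
    = (f a + f b) * ?I h - ?I (\<lambda>s. F s * h s) - ?I (\<lambda>s. F (- s) * h s)" .
  define c where "c = ((ln b - ln a) / 2) powr \<alpha> / Gamma \<alpha>"
  have refl: "?I (\<lambda>s. g (geo_path a b (- s))) = ?I h"
    "?I (\<lambda>s. f (geo_path a b (- s)) * g (geo_path a b (- s))) = ?I (\<lambda>s. F (- s) * h s)"
    by (intro integral_cong; simp add: h_even F_def)+
  have "hadamard_left \<alpha> a g b = c * ?I h" "hadamard_right \<alpha> b g a = c * ?I h"
    using hadamard_geo_path[OF \<alpha> g] unfolding refl by (simp_all only: c_def h_def)
  moreover have "hadamard_left \<alpha> a (\<lambda>x. f x * g x) b = c * ?I (\<lambda>s. F s * h s)"
    "hadamard_right \<alpha> b (\<lambda>x. f x * g x) a = c * ?I (\<lambda>s. F (- s) * h s)"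
    using hadamard_geo_path[OF \<alpha> continuous_on_mult[OF f g]]
    unfolding refl by (simp_all only: c_def h_def F_def)
  ultimately have "(f a + f b) / 2 * (hadamard_left \<alpha> a g b + hadamard_right \<alpha> b g a)
      - (hadamard_left \<alpha> a (\<lambda>x. f x * g x) b + hadamard_right \<alpha> b (\<lambda>x. f x * g x) a)
    = c * ((f a + f b) * ?I h - ?I (\<lambda>s. F s * h s) - ?I (\<lambda>s. F (- s) * h s))"
    by (simp only:) (simp add: algebra_simps)
  then show ?thesis
    unfolding eq[symmetric] by (simp only: c_def h_def F_def)
qed

section \<open>GA-convexity along the path\<close>

text \<open>Read outwards from the midpoint, each half of the path is a weighted geometric mean of
  an endpoint and sqrt(ab). This is the form in which GA-convexity and the integrands of
  \<open>C1\<close>, \<open>C2\<close>, \<open>C3\<close> are stated.\<close>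

lemma geo_path_eq_powr:
  "geo_path a b (- t) = a powr t * sqrt (a * b) powr (1 - t)"
  "geo_path a b t = b powr t * sqrt (a * b) powr (1 - t)"
proof -
  have "ln (sqrt (a * b)) = (ln a + ln b) / 2"
    using a ab by (simp add: ln_sqrt ln_mult)
  then show "geo_path a b (- t) = a powr t * sqrt (a * b) powr (1 - t)"
    "geo_path a b t = b powr t * sqrt (a * b) powr (1 - t)"
    using a ab by (simp_all add: geo_path_def powr_def field_simps flip: exp_add)
qed

lemma geo_path_powr:
  "geo_path a b (- t) powr q = a powr (q * t) * sqrt (a * b) powr (q * (1 - t))"
  "geo_path a b t powr q = b powr (q * t) * sqrt (a * b) powr (q * (1 - t))"
  using a ab unfolding geo_path_eq_powr(1)[of t] geo_path_eq_powr(2)[of t]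
  by (simp_all add: powr_mult powr_powr mult.commute)

text \<open>Convexity is applied on each half separately, between an endpoint and sqrt(ab), which is
  why the value at sqrt(ab) enters the final bound.\<close>

lemma GA_convex_on_geo_path:
  assumes "GA_convex_on {a..b} \<phi>" and t: "t \<in> {0..1}"
  shows "\<phi> (geo_path a b (- t)) \<le> t * \<phi> a + (1 - t) * \<phi> (sqrt (a * b))"
    and "\<phi> (geo_path a b t) \<le> t * \<phi> b + (1 - t) * \<phi> (sqrt (a * b))"
proof -
  have "sqrt (a * b) \<in> {a..b}"
    using geo_path_in_iff(1)[of 0] by (simp add: geo_path_0)
  then show "\<phi> (geo_path a b (- t)) \<le> t * \<phi> a + (1 - t) * \<phi> (sqrt (a * b))"
    "\<phi> (geo_path a b t) \<le> t * \<phi> b + (1 - t) * \<phi> (sqrt (a * b))"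
    using assms ab unfolding GA_convex_on_def geo_path_eq_powr(1)[of t] geo_path_eq_powr(2)[of t]
    by auto
qed

end

section \<open>The weight and the constants of the bound\<close>

lemma continuous_on_weight:
  fixes \<alpha> :: real
  assumes "0 < \<alpha>"
  shows "continuous_on {0..1} (\<lambda>t. (1 + t) powr \<alpha> - (1 - t) powr \<alpha>)"
  by (intro continuous_intros continuous_on_powr') (use assms in auto)

text \<open>The factor 2 matches the doubled mass in \<open>integral_powr_sum_le\<close>, so the
  right side is exactly the base of the power 1 - 1/q in the theorem.\<close>

lemma integral_weight:
  fixes \<alpha> :: real
  assumes "0 < \<alpha>"
  shows "2 * integral {0..1} (\<lambda>t. (1 + t) powr \<alpha> - (1 - t) powr \<alpha>)
    = (2 powr (\<alpha> + 2) - 2 ^ 2) / (\<alpha> + 1)"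
proof -
  let ?K = "\<lambda>t. ((1 + t) powr (\<alpha> + 1) + (1 - t) powr (\<alpha> + 1)) / (\<alpha> + 1)"
  have "((\<lambda>t. (1 + t) powr \<alpha> - (1 - t) powr \<alpha>) has_integral ?K 1 - ?K 0) {0..1}"
  proof (rule fundamental_theorem_of_calculus_interior)
    show "continuous_on {0..1} ?K"
      by (intro continuous_intros continuous_on_powr') (use assms in auto)
    show "(?K has_vector_derivative (1 + t) powr \<alpha> - (1 - t) powr \<alpha>) (at t)"
      if "t \<in> {0<..<1}" for t
    proof -
      have "((\<lambda>t. (1 + t) powr (\<alpha> + 1) + (1 - t) powr (\<alpha> + 1)) has_real_derivative
          (\<alpha> + 1) * ((1 + t) powr \<alpha> - (1 - t) powr \<alpha>)) (at t)"
        by (rule derivative_eq_intros refl | use that in \<open>simp add: algebra_simps\<close>)+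
      from DERIV_cdivide[OF this, of "\<alpha> + 1"] show ?thesis
        using assms by (simp add: has_real_derivative_iff_has_vector_derivative)
    qed
  qed simp
  then have "integral {0..1} (\<lambda>t. (1 + t) powr \<alpha> - (1 - t) powr \<alpha>) = ?K 1 - ?K 0"
    by (rule integral_unique)
  also have "?K 1 - ?K 0 = (2 powr (\<alpha> + 1) - 2) / (\<alpha> + 1)"
    using assms by (simp flip: diff_divide_distrib)
  finally show ?thesis
    by (simp add: powr_add)
qed

text \<open>\<open>A\<close>, \<open>M\<close>, \<open>B\<close> stand for |f'|^q at a, sqrt(ab), b.
  Regrouping by half of the path instead of by point value recovers the sum of the two convexity
  majorants.\<close>

lemma C_weighted_sum:
  assumes \<alpha>: "0 < \<alpha>" and ab: "0 < a" "0 < b"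
  defines "G \<equiv> sqrt (a * b)"
  shows "C1 \<alpha> q a b * A + C2 \<alpha> q a b * M + C3 \<alpha> q a b * B
    = integral {0..1} (\<lambda>t. ((1 + t) powr \<alpha> - (1 - t) powr \<alpha>) *
        (a powr (q * t) * G powr (q * (1 - t)) * (t * A + (1 - t) * M)
         + b powr (q * t) * G powr (q * (1 - t)) * (t * B + (1 - t) * M)))"
proof -
  let ?k = "\<lambda>t. (1 + t) powr \<alpha> - (1 - t) powr \<alpha>"
  let ?u = "\<lambda>t. a powr (q * t) * G powr (q * (1 - t))"
  let ?v = "\<lambda>t. b powr (q * t) * G powr (q * (1 - t))"
  have cont: "continuous_on {0..1} (\<lambda>t. ?k t * t * ?u t)"
    "continuous_on {0..1} (\<lambda>t. ?k t * (1 - t) * (?u t + ?v t))"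
    "continuous_on {0..1} (\<lambda>t. ?k t * t * ?v t)"
    by (intro continuous_intros continuous_on_weight \<alpha>; use ab in \<open>simp add: G_def\<close>)+
  have "C1 \<alpha> q a b = integral {0..1} (\<lambda>t. ?k t * t * ?u t)"
    "C2 \<alpha> q a b = integral {0..1} (\<lambda>t. ?k t * (1 - t) * (?u t + ?v t))"
    "C3 \<alpha> q a b = integral {0..1} (\<lambda>t. ?k t * t * ?v t)"
    unfolding C1_def C2_def C3_def Let_def G_def[symmetric]
    by (intro set_lebesgue_integral_eq_integral(2) absolutely_integrable_continuous_real cont)+
  then have "C1 \<alpha> q a b * A + C2 \<alpha> q a b * M + C3 \<alpha> q a b * B
    = integral {0..1} (\<lambda>t. ?k t * t * ?u t * A + ?k t * (1 - t) * (?u t + ?v t) * M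
        + ?k t * t * ?v t * B)"
    by (simp only: Henstock_Kurzweil_Integration.integral_add integrable_add
        Henstock_Kurzweil_Integration.integral_mult_left integrable_on_mult_left
        integrable_continuous_real cont)
  also have "\<dots> = integral {0..1} (\<lambda>t. ?k t * (?u t * (t * A + (1 - t) * M) + ?v t * (t * B + (1 - t) * M)))"
  proof (rule integral_cong)
    \<comment> \<open>The regrouping is polynomial in the weight and the powers, so it is proved for
      arbitrary reals in their place.\<close>
    have "k * t * u * A + k * (1 - t) * (u + v) * M + k * t * v * B
      = k * (u * (t * A + (1 - t) * M) + v * (t * B + (1 - t) * M))" for k t u v :: real
      by (simp add: algebra_simps)
    then show "?k t * t * ?u t * A + ?k t * (1 - t) * (?u t + ?v t) * M + ?k t * t * ?v t * B
      = ?k t * (?u t * (t * A + (1 - t) * M) + ?v t * (t * B + (1 - t) * M))" for t .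
  qed
  finally show ?thesis .
qed

section \<open>Continuity of f and the final estimate\<close>

text \<open>An endpoint a or b may lie on the boundary of \<open>I\<close>, where interior
  differentiability says nothing; the derivatives within \<open>I\<close> supply continuity
  there.\<close>

lemma has_real_derivative_imp_continuous_on_Icc:
  fixes f :: "real \<Rightarrow> real"
  assumes I: "is_interval I" and ends: "a \<in> I" "b \<in> I"
    and int: "\<And>x. x \<in> interior I \<Longrightarrow> (f has_real_derivative f' x) (at x)"
    and fa: "(f has_real_derivative f' a) (at a within I)"
    and fb: "(f has_real_derivative f' b) (at b within I)"
  shows "{a<..<b} \<subseteq> interior I" "continuous_on {a..b} f"
proof -
  have sub: "{a..b} \<subseteq> I"
    using mem_is_interval_1_I[OF I ends] by auto
  show int_sub: "{a<..<b} \<subseteq> interior I"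
    by (rule interior_maximal) (use sub in auto)
  show "continuous_on {a..b} f"
    unfolding continuous_on_eq_continuous_within
  proof
    fix x assume x: "x \<in> {a..b}"
    have "continuous (at x within I) f"
    proof (cases "x \<in> {a<..<b}")
      case True
      then show ?thesis
        using int_sub int DERIV_isCont continuous_at_imp_continuous_at_within by blast
    next
      case False
      with x have "x = a \<or> x = b" by auto
      then show ?thesis using fa fb DERIV_continuous by metis
    qed
    then show "continuous (at x within {a..b}) f"
      by (rule continuous_within_subset[OF _ sub])
  qed
qed

theorem corollary3:
  fixes I :: "real set" and f f' g :: "real \<Rightarrow> real" and a b p q \<alpha> :: real
  assumes "is_interval I" and "I \<subseteq> {0<..}"
    and "\<And>x. x \<in> interior I \<Longrightarrow> (f has_real_derivative f' x) (at x)"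
    and "a \<in> I" and "b \<in> I" and "a < b"
    and "(f has_real_derivative f' a) (at a within I)"
    and "(f has_real_derivative f' b) (at b within I)"
    and "continuous_on {a..b} g"
    and "\<And>x. x \<in> {a..b} \<Longrightarrow> 0 \<le> g x"
    and "geometrically_symmetric a b g"
    and "p > 1" and "q > 1" and "1 / q + 1 / p = 1"
    and "\<alpha> > 0"
    and "GA_convex_on {a..b} (\<lambda>x. \<bar>f' x\<bar> powr q)"
  shows "\<bar>(f a + f b) / 2 * (hadamard_left \<alpha> a g b + hadamard_right \<alpha> b g a)
            - (hadamard_left \<alpha> a (\<lambda>x. f x * g x) b + hadamard_right \<alpha> b (\<lambda>x. f x * g x) a)\<bar>
         \<le> (ln b - ln a) powr (\<alpha> + 1) * (SUP x\<in>{a..b}. \<bar>g x\<bar>)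
             / (2 powr (\<alpha> + 1) * Gamma (\<alpha> + 1))
           * ((2 powr (\<alpha> + 2) - 2 ^ 2) / (\<alpha> + 1)) powr (1 - 1 / q)
           * (C1 \<alpha> q a b * \<bar>f' a\<bar> powr q
              + C2 \<alpha> q a b * \<bar>f' (sqrt (a * b))\<bar> powr q
              + C3 \<alpha> q a b * \<bar>f' b\<bar> powr q) powr (1 / q)"
proof -
  note g = assms(9) and q = \<open>q > 1\<close> and \<alpha> = \<open>\<alpha> > 0\<close> and GA = assms(16)
  have a: "0 < a" and b: "0 < b" using assms by auto
  note path = a \<open>a < b\<close>
  have int_sub: "{a<..<b} \<subseteq> interior I" and f: "continuous_on {a..b} f"
    using has_real_derivative_imp_continuous_on_Icc[where f = f and f' = f'] assms by blast+
  define L where "L = (ln b - ln a) / 2"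
  have L: "0 < L" using path by (simp add: L_def)
  define N where "N = (SUP x\<in>{a..b}. \<bar>g x\<bar>)"
  \<comment> \<open>Boundedness on the compact interval makes the real-valued \<open>SUP\<close> a
    genuine upper bound.\<close>
  have "bounded (g ` {a..b})"
    by (intro compact_imp_bounded compact_continuous_image g) simp
  then have bdd: "bdd_above ((\<lambda>x. \<bar>g x\<bar>) ` {a..b})"
    by (auto simp: bounded_iff bdd_above_def)
  have gN: "g x \<le> N" if "x \<in> {a..b}" for x
    using cSUP_upper[OF that bdd] by (simp add: N_def)
  have "0 \<le> g a" "g a \<le> N" using assms(10)[of a] gN[of a] path by auto
  then have N: "0 \<le> N" by simp
  define k where "k = (\<lambda>t. (1 + t) powr \<alpha> - (1 - t) powr \<alpha>)"
  define G where "G = sqrt (a * b)"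
  \<comment> \<open>\<open>X\<close> and \<open>Y\<close> are the convexity majorants of (x
    |f'(x)|)^q at the path points of parameter -t and t; the factor x comes from the derivative of
    the path.\<close>
  define X where "X = (\<lambda>t. a powr (q * t) * G powr (q * (1 - t)) *
    (t * \<bar>f' a\<bar> powr q + (1 - t) * \<bar>f' G\<bar> powr q))"
  define Y where "Y = (\<lambda>t. b powr (q * t) * G powr (q * (1 - t)) *
    (t * \<bar>f' b\<bar> powr q + (1 - t) * \<bar>f' G\<bar> powr q))"
  have XY_cont: "continuous_on {0..1} X" "continuous_on {0..1} Y"
    unfolding X_def Y_def by (intro continuous_intros; use a b in \<open>simp add: G_def\<close>)+
  have XY_nonneg: "0 \<le> X t" "0 \<le> Y t" if "t \<in> {0..1}" for t
    using that by (auto simp: X_def Y_def)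
  define F' where "F' = (\<lambda>s. f' (geo_path a b s) * (geo_path a b s * L))"
  have F'_le: "\<bar>F' s\<bar> \<le> L * Z powr (1 / q)"
    if "geo_path a b s powr q * \<bar>f' (geo_path a b s)\<bar> powr q \<le> Z" for s Z
  proof -
    have "\<bar>F' s\<bar> = L * (geo_path a b s powr q * \<bar>f' (geo_path a b s)\<bar> powr q) powr (1 / q)"
      using L q geo_path_pos[OF path, of s]
      by (simp add: F'_def abs_mult powr_mult powr_powr)
    also have "\<dots> \<le> L * Z powr (1 / q)"
      using L q that by (intro mult_left_mono powr_mono2) auto
    finally show ?thesis .
  qed
  have F'_bound: "\<bar>F' s\<bar> + \<bar>F' (- s)\<bar> \<le> L * (X s powr (1 / q) + Y s powr (1 / q))"
    if "s \<in> {0..1}" for s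
  proof -
    have "\<bar>F' (- s)\<bar> \<le> L * X s powr (1 / q)" "\<bar>F' s\<bar> \<le> L * Y s powr (1 / q)"
      using GA_convex_on_geo_path[OF path GA that]
      unfolding X_def Y_def G_def geo_path_powr[OF path, symmetric]
      by (intro F'_le mult_left_mono; simp)+
    then show ?thesis by (simp add: algebra_simps)
  qed
  \<comment> \<open>The endpoint values stay in the form \<open>f (geo_path a b 1)\<close> and
    \<open>f (geo_path a b (-1))\<close>, so that the bracket is literally an instance with F the
    pull-back of f.\<close>
  have bound: "\<bar>integral {-1..1} (\<lambda>s. (1 - s) powr (\<alpha> - 1) * (g (geo_path a b s) *
        (f (geo_path a b 1) + f (geo_path a b (-1)) - f (geo_path a b s) - f (geo_path a b (- s)))))\<bar>
    \<le> N / \<alpha> * integral {0..1} (\<lambda>s. ((1 + s) powr \<alpha> - (1 - s) powr \<alpha>) *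
        (L * (X s powr (1 / q) + Y s powr (1 / q))))"
  proof (rule weighted_second_difference_bound[OF \<alpha>])
    show "continuous_on {-1..1} (\<lambda>s. g (geo_path a b s))"
      "continuous_on {-1..1} (\<lambda>s. f (geo_path a b s))"
      by (rule continuous_on_compose2[OF _ geo_path_continuous_on[OF path]],
          rule f g, simp add: geo_path_image[OF path])+
    show "0 \<le> g (geo_path a b s)" "g (geo_path a b s) \<le> N"
      "g (geo_path a b (- s)) = g (geo_path a b s)" if "s \<in> {-1..1}" for s
      using that geo_path_in_iff(1)[OF path, of s] assms(10,11) gN
      by (auto simp: geometrically_symmetric_def simp flip: geo_path_reflect[OF path])
    show "((\<lambda>s. f (geo_path a b s)) has_real_derivative F' s) (at s)" if "s \<in> {-1<..<1}" for s
    proof -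
      have "(f has_real_derivative f' (geo_path a b s)) (at (geo_path a b s))"
        using that geo_path_in_iff(2)[OF path, of s] int_sub assms(3) by blast
      from DERIV_chain2[OF this geo_path_deriv[OF path]] show ?thesis
        by (simp add: F'_def L_def)
    qed
    show "continuous_on {0..1} (\<lambda>s. L * (X s powr (1 / q) + Y s powr (1 / q)))"
      by (intro continuous_intros continuous_on_powr' XY_cont) (use XY_nonneg q in auto)
  qed (use F'_bound in auto)
  let ?E = "(f a + f b) / 2 * (hadamard_left \<alpha> a g b + hadamard_right \<alpha> b g a)
            - (hadamard_left \<alpha> a (\<lambda>x. f x * g x) b + hadamard_right \<alpha> b (\<lambda>x. f x * g x) a)"
  let ?S = "C1 \<alpha> q a b * \<bar>f' a\<bar> powr q + C2 \<alpha> q a b * \<bar>f' G\<bar> powr q + C3 \<alpha> q a b * \<bar>f' b\<bar> powr q"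
  let ?K = "(2 powr (\<alpha> + 2) - 2 ^ 2) / (\<alpha> + 1)"
  have K: "2 * integral {0..1} k = ?K"
    unfolding k_def by (rule integral_weight[OF \<alpha>])
  have "(2::real) powr 2 < 2 powr (\<alpha> + 2)"
    using \<alpha> by (intro powr_less_mono) auto
  then have "0 < ?K" using \<alpha> by simp
  then have K0: "0 < integral {0..1} k" using K by linarith
  have S: "integral {0..1} (\<lambda>t. k t * (X t + Y t)) = ?S"
    unfolding C_weighted_sum[OF \<alpha> a b] by (simp add: k_def X_def Y_def G_def)
  \<comment> \<open>Here r = 1/q, so 1 - r = 1/p.\<close>
  have Holder: "integral {0..1} (\<lambda>t. k t * (X t powr (1 / q) + Y t powr (1 / q)))
    \<le> ?K powr (1 - 1 / q) * ?S powr (1 / q)"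
    unfolding K[symmetric] S[symmetric]
  proof (rule integral_powr_sum_le)
    show "continuous_on {0..1} k"
      unfolding k_def by (rule continuous_on_weight[OF \<alpha>])
    show "0 \<le> k t" if "t \<in> {0..1}" for t
      using that \<alpha> by (auto simp: k_def intro!: powr_mono2)
  qed (use XY_cont XY_nonneg q K0 in auto)
  have "\<bar>?E\<bar> = L powr \<alpha> / Gamma \<alpha> * \<bar>integral {-1..1} (\<lambda>s. (1 - s) powr (\<alpha> - 1) *
        (g (geo_path a b s) * (f b + f a - f (geo_path a b s) - f (geo_path a b (- s)))))\<bar>"
    unfolding hadamard_trapezoid_geo_path[OF path \<alpha> f g assms(11)]
    using L \<alpha> by (simp add: abs_mult Gamma_real_pos less_imp_le flip: L_def)
  also have "\<dots> \<le> L powr \<alpha> / Gamma \<alpha> *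
      (N / \<alpha> * (L * integral {0..1} (\<lambda>s. k s * (X s powr (1 / q) + Y s powr (1 / q)))))"
    using bound \<alpha>
    by (intro mult_left_mono)
      (simp_all add: geo_path_ends[OF path] Gamma_real_pos less_imp_le mult.left_commute k_def)
  also have "\<dots> \<le> L powr \<alpha> / Gamma \<alpha> * (N / \<alpha> * (L * (?K powr (1 - 1 / q) * ?S powr (1 / q))))"
    using Holder L N \<alpha> by (intro mult_left_mono) (auto simp: Gamma_real_pos less_imp_le)
  \<comment> \<open>One factor \<open>L\<close> stems from the chain rule,
    \<open>L powr \<alpha>\<close> from the Hadamard integrals; as \<open>L\<close> is half of ln b
    - ln a, together they give the power \<alpha>+1 and the denominator 2^(\<alpha>+1).\<close>
  also have "\<dots> = (L * L powr \<alpha>) * N / (\<alpha> * Gamma \<alpha>) * ?K powr (1 - 1 / q) * ?S powr (1 / q)"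
    by (simp add: mult_ac)
  also have "\<alpha> * Gamma \<alpha> = Gamma (\<alpha> + 1)"
    proof (rule Gamma_plus1[symmetric])
    show "\<alpha> \<notin> \<int>\<^sub>\<le>\<^sub>0"
      using \<alpha> nonpos_Ints_nonpos[of \<alpha>] by linarith
  qed
  also have "L * L powr \<alpha> = (ln b - ln a) powr (\<alpha> + 1) / 2 powr (\<alpha> + 1)"
    using L by (simp add: powr_mult_base add.commute L_def powr_divide)
  finally show ?thesis
    by (simp add: N_def G_def)
qed

end
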